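(* For the Fano matroid $F_7$, the basis generating function $B_{F_7}$ and the spanning-set generating function $S_{F_7}$ are Rayleigh, but neither of them is Gårding.
   Context: $F_7$ is the rank-3 matroid on $\{1,\dots,7\}$ whose bases are the 3-element subsets other than the seven lines $\{1,2,3\},\{1,4,5\},\{1,6,7\},\{2,4,6\},\{2,5,7\},\{3,4,7\},\{3,5,6\}$. For a matroid $M$ on $E$, variables $w=(w_e)_{e\in E}$ and $w_T=\prod_{e\in T}w_e$, $B_M=\sum_{B\text{ basis}}w_B$ and $S_M=\sum_{T\text{ spanning}}w_T$, where $T\subseteq E$ is spanning if it contains a basis. Let $\Gamma_n^+=\{x\in\mathbb{R}^n:x_i>0\ \forall i\}$. A nonzero multi-affine polynomial $f$ is Gårding if some nonempty connected component $R$ of $\{f>0\}$ satisfies $R+\overline{\Gamma_n^+}\subset R$. A multi-affine polynomial $f$ with nonnegative coefficients is Rayleigh if $f\,\partial_i\partial_jf-\partial_if\,\partial_jf\le0$ on $\Gamma_n^+$ for all $i\neq j$. *)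

theory Defs
  imports "HOL-Analysis.Analysis"
begin

text \<open>
  The ground set of a matroid is a whole finite type, and the matroid is given by its set of
  bases. Real polynomials are identified with the functions they induce.
\<close>

locale matroid =
  fixes Bs :: "'n::finite set set"
  assumes nonempty: "Bs \<noteq> {}"
    and exchange: "\<lbrakk>A \<in> Bs; B \<in> Bs; a \<in> A - B\<rbrakk> \<Longrightarrow> \<exists>b \<in> B - A. insert b (A - {a}) \<in> Bs"

definition spanning_sets :: "'n::finite set set \<Rightarrow> 'n set set" where
  "spanning_sets Bs = {T. \<exists>B\<in>Bs. B \<subseteq> T}"

definition basis_gf :: "'n::finite set set \<Rightarrow> real ^ 'n \<Rightarrow> real" where
  "basis_gf Bs w = (\<Sum>B\<in>Bs. \<Prod>e\<in>B. w $ e)"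

definition spanning_gf :: "'n::finite set set \<Rightarrow> real ^ 'n \<Rightarrow> real" where
  "spanning_gf Bs w = (\<Sum>T\<in>spanning_sets Bs. \<Prod>e\<in>T. w $ e)"

definition multi_affine_with :: "('n::finite set \<Rightarrow> real) \<Rightarrow> (real ^ 'n \<Rightarrow> real) \<Rightarrow> bool" where
  "multi_affine_with c f \<longleftrightarrow> (\<forall>x. f x = (\<Sum>T\<in>UNIV. c T * (\<Prod>e\<in>T. x $ e)))"

definition multi_affine :: "(real ^ 'n::finite \<Rightarrow> real) \<Rightarrow> bool" where
  "multi_affine f \<longleftrightarrow> (\<exists>c. multi_affine_with c f)"

definition positive_orthant :: "(real ^ 'n::finite) set" where
  "positive_orthant = {x. \<forall>i. x $ i > 0}"

text \<open>Connected components, as given by \<^const>\<open>components\<close>, are nonempty.\<close>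

definition garding :: "(real ^ 'n::finite \<Rightarrow> real) \<Rightarrow> bool" where
  "garding f \<longleftrightarrow> multi_affine f \<and> f \<noteq> (\<lambda>x. 0) \<and>
     (\<exists>R \<in> components {x. f x > 0}. {x + y |x y. x \<in> R \<and> y \<in> closure positive_orthant} \<subseteq> R)"

definition partial_deriv :: "'n::finite \<Rightarrow> (real ^ 'n \<Rightarrow> real) \<Rightarrow> real ^ 'n \<Rightarrow> real" where
  "partial_deriv i f x = deriv (\<lambda>t. f (x + t *\<^sub>R axis i 1)) 0"

definition rayleigh :: "(real ^ 'n::finite \<Rightarrow> real) \<Rightarrow> bool" where
  "rayleigh f \<longleftrightarrow> (\<exists>c. (\<forall>T. c T \<ge> 0) \<and> multi_affine_with c f) \<and>
     (\<forall>i j. i \<noteq> j \<longrightarrow> (\<forall>x\<in>positive_orthant.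
        f x * partial_deriv i (partial_deriv j f) x - partial_deriv i f x * partial_deriv j f x \<le> 0))"

text \<open>
  The ground set is the seven-element numeral type, whose elements are 1, ..., 7
  (with 7 = 0, arithmetic in this type being modulo 7).
\<close>

definition fano_lines :: "7 set set" where
  "fano_lines = {{1,2,3}, {1,4,5}, {1,6,7}, {2,4,6}, {2,5,7}, {3,4,7}, {3,5,6}}"

definition fano_bases :: "7 set set" where
  "fano_bases = {B. card B = 3} - fano_lines"

lemma UNIV_7: "(UNIV :: 7 set) = {1,2,3,4,5,6,7}"
proof -
  have "card {1,2,3,4,5,6,7::7} = card (UNIV :: 7 set)"
    by simp
  then show ?thesis
    by (metis card_eq_UNIV_imp_eq_UNIV finite)
qed

lemma card_fano_line: "L \<in> fano_lines \<Longrightarrow> card L = 3"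
  by (auto simp: fano_lines_def)

lemma fano_lines_inter:
  assumes "L \<in> fano_lines" "M \<in> fano_lines" "p \<in> L" "q \<in> L" "p \<in> M" "q \<in> M" "p \<noteq> q"
  shows "L = M"
proof -
  have "\<forall>L\<in>fano_lines. \<forall>M\<in>fano_lines. \<forall>p\<in>L. \<forall>q\<in>L. p \<in> M \<longrightarrow> q \<in> M \<longrightarrow> p \<noteq> q \<longrightarrow> L = M"
    unfolding fano_lines_def by simp
  with assms show ?thesis by blast
qed

lemma fano_matroid: "matroid fano_bases"
proof
  have "{1,2,4} \<noteq> {1,2,3::7}" "{1,2,4} \<noteq> {1,4,5::7}" "{1,2,4} \<noteq> {1,6,7::7}" "{1,2,4} \<noteq> {2,4,6::7}"
    "{1,2,4} \<noteq> {2,5,7::7}" "{1,2,4} \<noteq> {3,4,7::7}" "{1,2,4} \<noteq> {3,5,6::7}"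
    by (simp_all add: set_eq_subset)
  then have "{1,2,4} \<in> fano_bases"
    by (simp add: fano_bases_def fano_lines_def)
  then show "fano_bases \<noteq> {}" by blast
next
  fix A B a
  assume A: "A \<in> fano_bases" and B: "B \<in> fano_bases" and a: "a \<in> A - B"
  have cA: "card A = 3" and cB: "card B = 3" and nB: "B \<notin> fano_lines"
    using A B by (auto simp: fano_bases_def)
  have "card (A - {a}) = 2" using cA a by simp
  then obtain p q where pq: "A - {a} = {p, q}" "p \<noteq> q" by (meson card_2_iff)
  show "\<exists>b\<in>B - A. insert b (A - {a}) \<in> fano_bases"
  proof (rule ccontr)
    assume neg: "\<not> ?thesis"
    have line: "insert b {p,q} \<in> fano_lines" if "b \<in> B - A" for b
    proof -
      have "b \<noteq> p" "b \<noteq> q" using that pq by auto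
      then have "card (insert b {p,q}) = 3" using pq by simp
      then show ?thesis using neg that pq by (auto simp: fano_bases_def)
    qed
    have "\<not> B \<subseteq> A"
      using a cA cB by (metis DiffD1 DiffD2 card_subset_eq finite)
    then obtain c where c: "c \<in> B - A" by blast
    have "B \<subseteq> insert c {p,q}"
    proof
      fix b assume b: "b \<in> B"
      show "b \<in> insert c {p,q}"
      proof (cases "b \<in> A")
        case True
        then show ?thesis using a b pq by blast
      next
        case False
        then have "insert b {p,q} = insert c {p,q}"
          using line b c pq(2) by (intro fano_lines_inter[of _ _ p q]) auto
        then show ?thesis by blast
      qed
    qed
    moreover have "card (insert c {p,q}) = 3" using card_fano_line line c by blast
    ultimately have "B = insert c {p,q}" using cB by (simp add: card_subset_eq)
    then show False using line[OF c] nB by simp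
  qed
qed

lemma multi_affine_with_sum:
  "multi_affine_with (indicator F) (\<lambda>w. \<Sum>T\<in>F. \<Prod>e\<in>T. w $ e)"
  by (simp add: multi_affine_with_def indicator_def if_distrib[of "\<lambda>c. c * _"] sum.If_cases cong: if_cong)

lemma multi_affine_basis_gf: "multi_affine (basis_gf Bs)"
  and multi_affine_spanning_gf: "multi_affine (spanning_gf Bs)"
  using multi_affine_with_sum[of Bs] multi_affine_with_sum[of "spanning_sets Bs"]
  unfolding multi_affine_def basis_gf_def[abs_def] spanning_gf_def[abs_def] by blast+

end

theory Submission imports Defs begin

text \<open>
  Rayleigh property.  A multi-affine \<open>f\<close> can be written
  \<open>f = w\<^sub>i w\<^sub>j A + w\<^sub>i B + w\<^sub>j C + D\<close> with \<open>A, B, C, D\<close> free of \<open>w\<^sub>i, w\<^sub>j\<close>, and then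
  \<open>f \<partial>\<^sub>i\<partial>\<^sub>jf - \<partial>\<^sub>if \<partial>\<^sub>jf = A D - B C\<close> (\<open>rayleigh_difference\<close>).  The automorphism group of the Fano
  plane is two-transitive (\<open>fano_two_transitive\<close>), so a single computation, in the remaining five
  variables, covers all pairs \<open>i \<noteq> j\<close>.  For both generating functions \<open>B C - A D\<close> turns out to be the
  square \<open>(w\<^sub>a w\<^sub>d - w\<^sub>b w\<^sub>c)\<^sup>2\<close> plus a polynomial with nonnegative coefficients
  (\<open>fano_basis_discriminant\<close>, \<open>fano_spanning_discriminant\<close>).

  Failure of the Garding property.  A component \<open>R\<close> of \<open>{f > 0}\<close> that is closed under nonnegative
  translations meets the positive orthant, and hence contains it, together with every point that can
  be joined to it inside \<open>{f > 0}\<close>.  It is therefore enough to walk from the positive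
  orthant along a segment in \<open>{f > 0}\<close> to a point from which a nonnegative translation leads to
  \<open>{f \<le> 0}\<close> (\<open>garding_segment\<close>).  For the basis generating function the coefficient
  of \<open>w\<^sub>1\<close> is \<open>\<alpha>\<beta> + \<alpha>\<gamma> + \<beta>\<gamma>\<close>, where \<open>\<alpha> = w\<^sub>2 + w\<^sub>3\<close>, \<open>\<beta> = w\<^sub>4 + w\<^sub>5\<close> and \<open>\<gamma> = w\<^sub>6 + w\<^sub>7\<close>, while
  the part free of \<open>w\<^sub>1\<close> contains the cubic term
  \<open>- (w\<^sub>2 - w\<^sub>3) (w\<^sub>4 - w\<^sub>5) (w\<^sub>6 - w\<^sub>7) / 2\<close> in the differences.  These differences do not affect the
  coefficient of \<open>w\<^sub>1\<close>, and choosing them large, with a negative product, makes the generating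
  function positive at a point where that coefficient is negative; increasing \<open>w\<^sub>1\<close> from there
  then makes it negative (\<open>fano_exit_path\<close>).

  The lowest-degree part of the spanning-set generating function is the basis generating function.
  After scaling by a small factor the two therefore have the same sign on a given compact set
  where the latter does not vanish (\<open>sgn_spanning_gf_small_scale\<close>), so the scaled path serves for
  spanning sets.
\<close>

section \<open>Mixed partial derivatives of multi-affine functions\<close>

lemma partial_deriv_affine:
  assumes "\<And>x t. f (x + t *\<^sub>R axis i 1) = f x + t * g x"
  shows "partial_deriv i f = g"
proof
  fix x
  have "((\<lambda>t. f x + t * g x) has_real_derivative g x) (at 0)"
    by (auto intro!: derivative_eq_intros)
  then show "partial_deriv i f x = g x"
    by (simp add: partial_deriv_def assms DERIV_imp_deriv)
qed

lemma rayleigh_difference: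
  fixes f A B C D :: "real ^ 'n::finite \<Rightarrow> real"
  assumes ij: "i \<noteq> j"
    and f: "\<And>w. f w = w $ i * w $ j * A w + w $ i * B w + w $ j * C w + D w"
    and indep: "\<And>g k w t. g \<in> {A, B, C, D} \<Longrightarrow> k \<in> {i, j} \<Longrightarrow> g (w + t *\<^sub>R axis k 1) = g w"
  shows "f w * partial_deriv i (partial_deriv j f) w - partial_deriv i f w * partial_deriv j f w
       = A w * D w - B w * C w"
proof -
  have coord: "(axis k 1 :: real ^ 'n) $ l = (if l = k then 1 else 0)" for k l
    by (simp add: axis_def)
  have "partial_deriv i f = (\<lambda>w. w $ j * A w + B w)"
    using ij by (intro partial_deriv_affine) (simp add: f indep coord algebra_simps)
  moreover have j: "partial_deriv j f = (\<lambda>w. w $ i * A w + C w)"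
    using ij by (intro partial_deriv_affine) (simp add: f indep coord algebra_simps)
  moreover have "partial_deriv i (partial_deriv j f) = A"
    unfolding j using ij by (intro partial_deriv_affine) (simp add: indep coord algebra_simps)
  ultimately show ?thesis
    by (simp add: f algebra_simps)
qed

section \<open>Generating functions through elementary symmetric sums\<close>

text \<open>
  The lines are the only three-element sets that are not bases, so both generating functions are
  elementary symmetric up to the sum over the lines.  The recursion \<open>elem_sym_insert\<close> makes the
  symmetric part computable by rewriting.
\<close>

definition elem_sym :: "nat \<Rightarrow> 'a set \<Rightarrow> ('a \<Rightarrow> real) \<Rightarrow> real" where
  "elem_sym k A w = (\<Sum>T | T \<subseteq> A \<and> card T = k. \<Prod>e\<in>T. w e)"

lemma elem_sym_0: "finite A \<Longrightarrow> elem_sym 0 A w = 1"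
proof -
  assume "finite A"
  then have "{T. T \<subseteq> A \<and> card T = 0} = {{}}"
    by (auto dest: finite_subset)
  then show ?thesis by (simp add: elem_sym_def)
qed

lemma elem_sym_empty: "elem_sym (Suc k) {} w = 0"
  by (simp add: elem_sym_def sum.neutral)

lemma elem_sym_insert:
  assumes "finite A" "a \<notin> A"
  shows "elem_sym (Suc k) (insert a A) w = elem_sym (Suc k) A w + w a * elem_sym k A w"
proof -
  let ?F = "\<lambda>k. {T. T \<subseteq> A \<and> card T = k}"
  have split: "{T. T \<subseteq> insert a A \<and> card T = Suc k} = ?F (Suc k) \<union> insert a ` ?F k"
  proof (intro equalityI subsetI)
    fix T assume T: "T \<in> {T. T \<subseteq> insert a A \<and> card T = Suc k}"
    show "T \<in> ?F (Suc k) \<union> insert a ` ?F k"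
    proof (cases "a \<in> T")
      case True
      then have "T = insert a (T - {a})" "T - {a} \<subseteq> A" "card (T - {a}) = k"
        using T by auto
      then show ?thesis by blast
    qed (use T in auto)
  next
    fix T assume "T \<in> ?F (Suc k) \<union> insert a ` ?F k"
    then show "T \<in> {T. T \<subseteq> insert a A \<and> card T = Suc k}"
      using assms finite_subset[of _ A] by (auto simp: card_insert_if)
  qed
  have "inj_on (insert a) (?F k)"
    using assms(2) by (intro inj_onI) (metis (mono_tags, lifting) insert_ident mem_Collect_eq subsetD)
  then have "(\<Sum>T\<in>insert a ` ?F k. prod w T) = (\<Sum>T\<in>?F k. prod w (insert a T))"
    by (simp add: sum.reindex)
  also have "\<dots> = (\<Sum>T\<in>?F k. w a * prod w T)"
  proof (rule sum.cong[OF refl])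
    fix T assume "T \<in> ?F k"
    then have "finite T" "a \<notin> T" using assms finite_subset[of T A] by auto
    then show "prod w (insert a T) = w a * prod w T" by simp
  qed
  finally have "(\<Sum>T\<in>insert a ` ?F k. prod w T) = w a * elem_sym k A w"
    by (simp add: elem_sym_def sum_distrib_left)
  moreover have "(\<Sum>T\<in>?F (Suc k) \<union> insert a ` ?F k. prod w T)
      = elem_sym (Suc k) A w + (\<Sum>T\<in>insert a ` ?F k. prod w T)"
    unfolding elem_sym_def using assms by (intro sum.union_disjoint) auto
  ultimately show ?thesis by (simp add: elem_sym_def split)
qed

lemma basis_gf_fano:
  "basis_gf fano_bases w = elem_sym 3 UNIV (($) w) - (\<Sum>L\<in>fano_lines. \<Prod>e\<in>L. w $ e)"
  unfolding basis_gf_def fano_bases_def elem_sym_def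
  by (subst sum_diff) (auto simp: card_fano_line)

text \<open>
  A set with at least four elements spans: if a three-element subset is a line, then exchanging one
  of its points for a point off the line gives a basis, since two lines share at most one point.
\<close>

lemma spanning_sets_fano: "spanning_sets fano_bases = UNIV - ({T. card T \<le> 2} \<union> fano_lines)"
proof (intro equalityI subsetI)
  fix T assume "T \<in> spanning_sets fano_bases"
  then obtain B where B: "card B = 3" "B \<notin> fano_lines" "B \<subseteq> T"
    by (auto simp: spanning_sets_def fano_bases_def)
  then have "3 \<le> card T" by (metis card_mono finite)
  moreover have "T \<notin> fano_lines"
    using B card_fano_line[of T] card_subset_eq[of T B] by auto
  ultimately show "T \<in> UNIV - ({T. card T \<le> 2} \<union> fano_lines)" by simp
next
  fix T assume "T \<in> UNIV - ({T. card T \<le> 2} \<union> fano_lines)"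
  then have T: "3 \<le> card T" "T \<notin> fano_lines" by auto
  obtain L where L: "L \<subseteq> T" "card L = 3"
    using obtain_subset_with_card_n[OF T(1)] by metis
  show "T \<in> spanning_sets fano_bases"
  proof (cases "L \<in> fano_lines")
    case False
    then show ?thesis using L by (auto simp: spanning_sets_def fano_bases_def)
  next
    case True
    then obtain c where c: "c \<in> T" "c \<notin> L" using L(1) T(2) by (metis subsetI subset_antisym)
    obtain p q r where pqr: "L = {p, q, r}" "p \<noteq> q" "p \<noteq> r" "q \<noteq> r"
      using L(2) by (auto simp: card_3_iff)
    have "{c, p, q} \<notin> fano_lines"
      using fano_lines_inter[of "{c, p, q}" L p q] True pqr c(2) by blast
    moreover have "card {c, p, q} = 3" using c pqr by auto
    ultimately show ?thesis using c L pqr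
      by (auto simp: spanning_sets_def fano_bases_def intro!: bexI[of _ "{c, p, q}"])
  qed
qed

lemma spanning_gf_fano:
  "spanning_gf fano_bases w = (\<Prod>e\<in>UNIV. 1 + w $ e)
     - (1 + elem_sym 1 UNIV (($) w) + elem_sym 2 UNIV (($) w) + (\<Sum>L\<in>fano_lines. \<Prod>e\<in>L. w $ e))"
proof -
  let ?p = "\<lambda>T. \<Prod>e\<in>T. w $ e"
  have all: "(\<Prod>e\<in>UNIV. 1 + w $ e) = (\<Sum>T\<in>UNIV. ?p T)"
    using prod_add[of UNIV "($) w" "\<lambda>_. 1"] by (simp add: add.commute)
  have "{T :: 7 set. card T \<le> 2} = {T. card T = 0} \<union> {T. card T = 1} \<union> {T. card T = 2}"
    by (simp add: set_eq_iff le_Suc_eq numeral_2_eq_2 disj_ac del: card_0_eq)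
  then have "sum ?p {T. card T \<le> 2} = sum ?p {T. card T = 0} + sum ?p {T. card T = 1} + sum ?p {T. card T = 2}"
    by (simp only:) (subst sum.union_disjoint; auto)+
  then have small: "sum ?p {T. card T \<le> 2} = 1 + elem_sym 1 UNIV (($) w) + elem_sym 2 UNIV (($) w)"
    using elem_sym_0[of UNIV "($) w"] by (simp add: elem_sym_def)
  have "sum ?p ({T. card T \<le> 2} \<union> fano_lines) = sum ?p {T. card T \<le> 2} + sum ?p fano_lines"
    by (rule sum.union_disjoint) (auto simp: card_fano_line)
  then show ?thesis
    unfolding spanning_gf_def spanning_sets_fano by (subst sum_diff) (auto simp: all small)
qed

section \<open>Two-transitivity of the Fano plane\<close>

text \<open>
  The labels are laid out so that \<open>1, \<dots>, 7\<close> in their natural order form a labelling.  A labelling is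
  the image of that one under an automorphism of the plane.
\<close>

definition fano_labelling :: "7 \<Rightarrow> 7 \<Rightarrow> 7 \<Rightarrow> 7 \<Rightarrow> 7 \<Rightarrow> 7 \<Rightarrow> 7 \<Rightarrow> bool" where
  "fano_labelling i j x a b c d \<longleftrightarrow> distinct [i, j, x, a, b, c, d] \<and>
     fano_lines = {{i,j,x}, {i,a,b}, {i,c,d}, {j,a,c}, {j,b,d}, {x,a,d}, {x,b,c}}"

lemma fano_labelling_UNIV:
  assumes "fano_labelling i j x a b c d"
  shows "UNIV = {i, j, x, a, b, c, d}"
proof -
  have "card {i, j, x, a, b, c, d} = card (UNIV :: 7 set)"
    using assms by (simp add: fano_labelling_def)
  then show ?thesis by (metis card_eq_UNIV_imp_eq_UNIV finite)
qed

lemma fano_labelling_1: "fano_labelling 1 2 3 4 5 6 7"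
  by (simp add: fano_labelling_def fano_lines_def)

text \<open>
  Automorphisms of the plane, as relabellings.  The first exchanges \<open>i\<close> and \<open>j\<close>; the
  others fix \<open>i\<close>, and together they can bring any other point to the place of \<open>j\<close>.
\<close>

lemma fano_labelling_moves:
  assumes "fano_labelling i j x a b c d"
  shows "fano_labelling j i x a c b d" "fano_labelling i x j a b d c"
    "fano_labelling i a b j x c d" "fano_labelling i c d j x a b"
  using assms unfolding fano_labelling_def by (auto simp: insert_commute)

lemma fano_labelling_fix_first:
  assumes "fano_labelling i j x a b c d" "k \<noteq> i"
  shows "\<exists>x a b c d. fano_labelling i k x a b c d"
proof -
  have "k \<in> {j, x, a, b, c, d}"
    using fano_labelling_UNIV[OF assms(1)] assms(2) by blast
  moreover note a = fano_labelling_moves(3)[OF assms(1)]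
  moreover note c = fano_labelling_moves(4)[OF assms(1)]
  moreover note fano_labelling_moves(2)[OF assms(1)] fano_labelling_moves(2)[OF a]
    fano_labelling_moves(2)[OF c]
  ultimately show ?thesis
    using assms(1) by - (elim insertE emptyE; hypsubst; intro exI; assumption)
qed

lemma fano_two_transitive:
  assumes "i \<noteq> j"
  shows "\<exists>x a b c d. fano_labelling i j x a b c d"
proof (cases "i = 1")
  case True
  then show ?thesis using fano_labelling_fix_first[OF fano_labelling_1, of j] assms by simp
next
  case False
  then obtain x a b c d where "fano_labelling 1 i x a b c d"
    using fano_labelling_fix_first[OF fano_labelling_1] by blast
  then show ?thesis
    using fano_labelling_fix_first[OF fano_labelling_moves(1), of 1 i x a b c d j] assms by auto
qed

lemma sum_fano_lines:
  assumes "fano_labelling i j x a b c d"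
  shows "(\<Sum>L\<in>fano_lines. \<Prod>e\<in>L. w $ e) =
    w$i*w$j*w$x + w$i*w$a*w$b + w$i*w$c*w$d + w$j*w$a*w$c + w$j*w$b*w$d + w$x*w$a*w$d + w$x*w$b*w$c"
proof -
  let ?ls = "[{i,j,x}, {i,a,b}, {i,c,d}, {j,a,c}, {j,b,d}, {x,a,d}, {x,b,c}]"
  have lines: "fano_lines = set ?ls"
    and dist: "distinct [i, j, x, a, b, c, d]"
    using assms by (simp_all add: fano_labelling_def)
  then have "distinct ?ls" by (clarsimp simp: set_eq_subset)
  from sum.distinct_set_conv_list[OF this, of "\<lambda>L. \<Prod>e\<in>L. w $ e"]
  show ?thesis
    unfolding lines using dist by (simp add: mult.assoc add.assoc)
qed

text \<open>
  The four coefficients with respect to \<open>w\<^sub>i\<close> and \<open>w\<^sub>j\<close> belong to the minors in which each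
  of \<open>i\<close> and \<open>j\<close> is contracted or deleted.  Contracting \<open>i\<close> and deleting \<open>j\<close> leaves the parallel
  classes \<open>x\<close>, \<open>ab\<close>, \<open>cd\<close>; with \<open>i\<close> and \<open>j\<close> exchanged they are \<open>x\<close>, \<open>ac\<close>, \<open>bd\<close>.
\<close>

lemma basis_gf_fano_labelled:
  assumes l: "fano_labelling i j x a b c d"
  shows "basis_gf fano_bases w =
    w$i * w$j * (w$a + w$b + w$c + w$d)
    + w$i * (w$x * (w$a + w$b + w$c + w$d) + (w$a + w$b) * (w$c + w$d))
    + w$j * (w$x * (w$a + w$b + w$c + w$d) + (w$a + w$c) * (w$b + w$d))
    + (w$x * (w$a + w$d) * (w$b + w$c)
       + (w$a*w$b*w$c + w$a*w$b*w$d + w$a*w$c*w$d + w$b*w$c*w$d))"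
  using l unfolding basis_gf_fano sum_fano_lines[OF l] fano_labelling_UNIV[OF l] fano_labelling_def
  by (simp add: elem_sym_insert elem_sym_0 elem_sym_empty numeral_eq_Suc algebra_simps)

lemma spanning_gf_fano_labelled:
  assumes l: "fano_labelling i j x a b c d"
  shows "spanning_gf fano_bases w =
    w$i * w$j * ((1 + w$x) * ((1 + w$a) * (1 + w$b) * (1 + w$c) * (1 + w$d) - 1))
    + w$i * ((1 + w$x) * ((1 + w$a) * (1 + w$b) * (1 + w$c) * (1 + w$d) - 1)
        - ((1 + w$a) * (1 + w$b) + (1 + w$c) * (1 + w$d) - 2))
    + w$j * ((1 + w$x) * ((1 + w$a) * (1 + w$b) * (1 + w$c) * (1 + w$d) - 1)
        - ((1 + w$a) * (1 + w$c) + (1 + w$b) * (1 + w$d) - 2))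
    + ((1 + w$x) * ((1 + w$a) * (1 + w$b) * (1 + w$c) * (1 + w$d) - 1
          - (w$a + w$b + w$c + w$d) - w$a*w$d - w$b*w$c)
        - (w$a + w$d) * (w$b + w$c))"
proof -
  define P where "P = (1 + w$a) * (1 + w$b) * (1 + w$c) * (1 + w$d)"
  have dist: "distinct [i, j, x, a, b, c, d]"
    using l by (simp add: fano_labelling_def)
  have prod: "(\<Prod>e\<in>UNIV. 1 + w $ e) = (1 + w$i) * (1 + w$j) * (1 + w$x) * P"
    using dist unfolding fano_labelling_UNIV[OF l] P_def by (simp add: mult.assoc)
  have e1: "elem_sym 1 UNIV (($) w) = w$i + w$j + w$x + w$a + w$b + w$c + w$d"
    using dist unfolding fano_labelling_UNIV[OF l]
    by (simp add: elem_sym_insert elem_sym_0 elem_sym_empty)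
  have e2: "elem_sym 2 UNIV (($) w) = w$i * w$j + (w$i + w$j) * (w$x + w$a + w$b + w$c + w$d)
      + w$x * (w$a + w$b + w$c + w$d) + w$a * w$b + (w$a + w$b) * (w$c + w$d) + w$c * w$d"
    using dist unfolding fano_labelling_UNIV[OF l]
    by (simp add: elem_sym_insert elem_sym_0 elem_sym_empty numeral_eq_Suc algebra_simps)
  (* P stays unexpanded: both sides are linear in it with the same coefficient *)
  show ?thesis
    unfolding spanning_gf_fano sum_fano_lines[OF l] prod e1 e2 P_def[symmetric]
    by (simp add: algebra_simps)
qed

section \<open>The Rayleigh property\<close>

lemma fano_basis_discriminant:
  fixes a b c d x :: real
  assumes nonneg: "0 \<le> a" "0 \<le> b" "0 \<le> c" "0 \<le> d" "0 \<le> x"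
  shows "(a + b + c + d) * (x * (a + d) * (b + c) + (a*b*c + a*b*d + a*c*d + b*c*d))
      - (x * (a + b + c + d) + (a + b) * (c + d)) * (x * (a + b + c + d) + (a + c) * (b + d)) \<le> 0"
    (is "?l \<le> 0")
proof -
  have "- ?l = (x * (a + b + c + d))\<^sup>2 + 2 * (x * (a + b + c + d) * (a * d + b * c)) + (a * d - b * c)\<^sup>2"
    by (simp add: power2_eq_square algebra_simps)
  also have "0 \<le> \<dots>"
    using nonneg by simp
  finally show ?thesis by simp
qed

text \<open>
  The expression is a quadratic polynomial in \<open>x\<close> whose coefficients become transparent once
  \<open>Q\<close> is kept unexpanded: only the constant term needs the expansion of \<open>Q\<close>.
\<close>

lemma fano_spanning_discriminant:
  fixes a b c d x :: real
  defines "Q \<equiv> (1 + a) * (1 + b) * (1 + c) * (1 + d) - 1"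
  assumes nonneg: "0 \<le> a" "0 \<le> b" "0 \<le> c" "0 \<le> d" "0 \<le> x"
  shows "(1 + x) * Q * ((1 + x) * (Q - (a + b + c + d) - a*d - b*c) - (a + d) * (b + c))
      - ((1 + x) * Q - ((1 + a) * (1 + b) + (1 + c) * (1 + d) - 2))
        * ((1 + x) * Q - ((1 + a) * (1 + c) + (1 + b) * (1 + d) - 2)) \<le> 0"
    (is "?l \<le> 0")
proof -
  let ?s = "a + b + c + d" and ?m = "a * d + b * c"
  let ?p = "(1 + a) * (1 + b) + (1 + c) * (1 + d) - 2"
  let ?q = "(1 + a) * (1 + c) + (1 + b) * (1 + d) - 2"
  have "Q * (?m - ?s) + ?p * ?q
      = (a * d - b * c)\<^sup>2 + (a * d)\<^sup>2 * (b + c + b * c) + (b * c)\<^sup>2 * (a + d + a * d)"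
    unfolding Q_def by (simp add: power2_eq_square algebra_simps)
  moreover have "?p + ?q - (a + d) * (b + c) = 2 * ?s"
    by (simp add: algebra_simps)
  ultimately have "- ?l = x\<^sup>2 * (Q * (?s + ?m)) + 2 * (x * (Q * ?m))
      + ((a * d - b * c)\<^sup>2 + (a * d)\<^sup>2 * (b + c + b * c) + (b * c)\<^sup>2 * (a + d + a * d))"
    by algebra
  also have "0 \<le> \<dots>"
  proof -
    have "1 \<le> (1 + a) * (1 + b) * (1 + c) * (1 + d)"
      using nonneg by (intro mult_ge1_I) auto
    then have "0 \<le> Q" by (simp add: Q_def)
    then show ?thesis using nonneg by simp
  qed
  finally show ?thesis by simp
qed

text \<open>By two-transitivity every pair \<open>i \<noteq> j\<close> is the initial pair of some labelling.\<close>

lemma rayleigh_fanoI: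
  fixes f :: "real ^ 7 \<Rightarrow> real"
  assumes ma: "multi_affine_with (indicator F) f"
    and diff: "\<And>i j x a b c d w. fano_labelling i j x a b c d \<Longrightarrow> (\<And>k. 0 \<le> w $ k) \<Longrightarrow>
      f w * partial_deriv i (partial_deriv j f) w - partial_deriv i f w * partial_deriv j f w \<le> 0"
  shows "rayleigh f"
  unfolding rayleigh_def
proof (intro conjI allI impI ballI)
  show "\<exists>c. (\<forall>T. 0 \<le> c T) \<and> multi_affine_with c f"
    using ma by (intro exI[of _ "indicator F"]) simp
next
  fix i j :: 7 and w :: "real ^ 7" assume "i \<noteq> j" and w: "w \<in> positive_orthant"
  then obtain x a b c d where "fano_labelling i j x a b c d"
    using fano_two_transitive by blast
  moreover have "0 \<le> w $ k" for k
    using w by (simp add: positive_orthant_def less_imp_le)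
  ultimately show "f w * partial_deriv i (partial_deriv j f) w - partial_deriv i f w * partial_deriv j f w \<le> 0"
    by (rule diff)
qed

lemma fano_labelling_axis:
  assumes "fano_labelling i j x a b c d" "k \<in> {i, j}"
  shows "axis k (1 :: real) $ x = 0" "axis k (1 :: real) $ a = 0" "axis k (1 :: real) $ b = 0"
    "axis k (1 :: real) $ c = 0" "axis k (1 :: real) $ d = 0"
  using assms by (auto simp: fano_labelling_def axis_def)

lemma rayleigh_basis_gf_fano: "rayleigh (basis_gf fano_bases)"
proof (rule rayleigh_fanoI)
  show "multi_affine_with (indicator fano_bases) (basis_gf fano_bases)"
    unfolding basis_gf_def[abs_def] by (rule multi_affine_with_sum)
next
  fix i j x a b c d and w :: "real ^ 7"
  assume l: "fano_labelling i j x a b c d" and w: "\<And>k. 0 \<le> w $ k"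
  have ij: "i \<noteq> j" using l by (simp add: fano_labelling_def)
  show "basis_gf fano_bases w * partial_deriv i (partial_deriv j (basis_gf fano_bases)) w
      - partial_deriv i (basis_gf fano_bases) w * partial_deriv j (basis_gf fano_bases) w \<le> 0"
    by (rule ord_eq_le_trans[OF rayleigh_difference[OF ij basis_gf_fano_labelled[OF l]]
        fano_basis_discriminant[OF w w w w w]])
      (elim insertE emptyE; simp add: fano_labelling_axis[OF l])
qed

lemma rayleigh_spanning_gf_fano: "rayleigh (spanning_gf fano_bases)"
proof (rule rayleigh_fanoI)
  show "multi_affine_with (indicator (spanning_sets fano_bases)) (spanning_gf fano_bases)"
    unfolding spanning_gf_def[abs_def] by (rule multi_affine_with_sum)
next
  fix i j x a b c d and w :: "real ^ 7"
  assume l: "fano_labelling i j x a b c d" and w: "\<And>k. 0 \<le> w $ k"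
  have ij: "i \<noteq> j" using l by (simp add: fano_labelling_def)
  show "spanning_gf fano_bases w * partial_deriv i (partial_deriv j (spanning_gf fano_bases)) w
      - partial_deriv i (spanning_gf fano_bases) w * partial_deriv j (spanning_gf fano_bases) w \<le> 0"
    by (rule ord_eq_le_trans[OF rayleigh_difference[OF ij spanning_gf_fano_labelled[OF l]]
        fano_spanning_discriminant[OF w w w w w]])
      (elim insertE emptyE; simp add: fano_labelling_axis[OF l])
qed

section \<open>Failure of the Garding property\<close>

lemma nonneg_in_closure_positive_orthant:
  fixes y :: "real ^ 'n::finite"
  assumes "\<And>i. 0 \<le> y $ i"
  shows "y \<in> closure positive_orthant"
proof -
  define s :: "nat \<Rightarrow> real ^ 'n" where "s n = y + inverse (real (Suc n)) *\<^sub>R (\<chi> i. 1)" for n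
  have "s \<longlonglongrightarrow> y + 0 *\<^sub>R (\<chi> i. 1)"
    unfolding s_def by (intro tendsto_intros LIMSEQ_inverse_real_of_nat)
  then have "s \<longlonglongrightarrow> y" by simp
  moreover have "s n \<in> positive_orthant" for n
    using assms by (simp add: s_def positive_orthant_def add_nonneg_pos)
  ultimately show ?thesis
    unfolding closure_sequential by blast
qed

text \<open>
  Translating any point of the component far enough in all coordinates lands in the positive
  orthant, which is connected and on which \<open>f\<close> is positive; so the component contains the orthant,
  then the segment, and then every nonnegative translate of its endpoint.
\<close>

lemma garding_segment:
  fixes f :: "real ^ 'n::finite \<Rightarrow> real"
  assumes f: "garding f"
    and pos: "\<And>w. w \<in> positive_orthant \<Longrightarrow> 0 < f w"
    and u: "u \<in> positive_orthant"
    and seg: "\<And>w. w \<in> closed_segment u v \<Longrightarrow> 0 < f w"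
    and y: "\<And>i. 0 \<le> y $ i"
  shows "0 < f (v + y)"
proof -
  obtain R where R: "R \<in> components {x. 0 < f x}"
    and shift: "\<And>r z. r \<in> R \<Longrightarrow> z \<in> closure positive_orthant \<Longrightarrow> r + z \<in> R"
    using f unfolding garding_def by blast
  obtain r where "r \<in> R"
    using in_components_nonempty[OF R] by blast
  define z :: "real ^ 'n" where "z = (\<chi> i. 1 + \<bar>r $ i\<bar>)"
  have "r + z \<in> R"
    by (intro shift \<open>r \<in> R\<close> nonneg_in_closure_positive_orthant) (simp add: z_def)
  moreover have "r + z \<in> positive_orthant"
    by (auto simp: z_def positive_orthant_def intro: less_le_trans[of 0 1])
  moreover have "convex (positive_orthant :: (real ^ 'n) set)"
    by (auto simp: convex_def positive_orthant_def add_nonneg_pos add_pos_nonneg)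
      (metis add_nonneg_pos add.commute add.right_neutral less_eq_real_def mult_nonneg_nonneg mult_pos_pos zero_less_one)
  ultimately have "positive_orthant \<subseteq> R"
    using pos by (intro components_maximal[OF R] convex_connected) auto
  then have "closed_segment u v \<subseteq> R"
    using u seg by (intro components_maximal[OF R] convex_connected convex_closed_segment) auto
  then have "v + y \<in> R"
    by (intro shift nonneg_in_closure_positive_orthant y) auto
  then show ?thesis
    using in_components_subset[OF R] by blast
qed

text \<open>
  At \<open>l w\<close> the spanning-set generating function is \<open>l\<^sup>r\<close> times the basis generating function at \<open>w\<close>
  plus a remainder: all spanning sets other than bases have more than \<open>r\<close> elements, so this
  remainder is \<open>O(l)\<close> uniformly on the compact set.
\<close>

lemma sgn_spanning_gf_small_scale:
  fixes Bs :: "'n::finite set set" and K :: "(real ^ 'n) set"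
  assumes rank: "\<And>B. B \<in> Bs \<Longrightarrow> card B = r"
    and K: "compact K" and nz: "\<And>w. w \<in> K \<Longrightarrow> basis_gf Bs w \<noteq> 0"
  shows "\<exists>l>0. \<forall>w\<in>K. sgn (spanning_gf Bs (l *\<^sub>R w)) = sgn (basis_gf Bs w)"
proof (cases "K = {}")
  case True
  then show ?thesis by (intro exI[of _ 1]) simp
next
  case False
  let ?N = "spanning_sets Bs - Bs" and ?p = "\<lambda>(w :: real ^ 'n) T. \<Prod>e\<in>T. w $ e"
  have card_N: "r < card T" if T: "T \<in> ?N" for T
  proof -
    obtain B where B: "B \<in> Bs" "B \<subseteq> T"
      using T unfolding spanning_sets_def by blast
    then have "B \<subset> T" using T by blast
    then show ?thesis using psubset_card_mono[of T B] rank[OF B(1)] by simp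
  qed
  have "continuous_on K (\<lambda>w. \<bar>basis_gf Bs w\<bar>)"
    unfolding basis_gf_def by (intro continuous_intros)
  then obtain w1 where w1: "w1 \<in> K" "\<And>w. w \<in> K \<Longrightarrow> \<bar>basis_gf Bs w1\<bar> \<le> \<bar>basis_gf Bs w\<bar>"
    using continuous_attains_inf[OF K False] by blast
  have "continuous_on K (\<lambda>w. \<Sum>T\<in>?N. \<bar>?p w T\<bar>)"
    by (intro continuous_intros)
  then obtain w2 where w2: "\<And>w. w \<in> K \<Longrightarrow> (\<Sum>T\<in>?N. \<bar>?p w T\<bar>) \<le> (\<Sum>T\<in>?N. \<bar>?p w2 T\<bar>)"
    using continuous_attains_sup[OF K False] by blast
  define m where "m = \<bar>basis_gf Bs w1\<bar>"
  define C where "C = (\<Sum>T\<in>?N. \<bar>?p w2 T\<bar>)"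
  (* C + 1 rather than C keeps the denominator positive and makes the final estimate strict *)
  define l where "l = min 1 (m / (C + 1))"
  have "0 < m" using nz w1(1) by (simp add: m_def)
  have "0 \<le> C" by (simp add: C_def sum_nonneg)
  have l: "0 < l" "l \<le> 1" "l \<le> m / (C + 1)"
    using \<open>0 < m\<close> \<open>0 \<le> C\<close> by (simp_all add: l_def)
  have lC: "l * (C + 1) \<le> m"
    using l(3) \<open>0 \<le> C\<close> by (simp add: pos_le_divide_eq)
  have "sgn (spanning_gf Bs (l *\<^sub>R w)) = sgn (basis_gf Bs w)" if w: "w \<in> K" for w
  proof -
    define rest where "rest = (\<Sum>T\<in>?N. l ^ (card T - r) * ?p w T)"
    have "spanning_sets Bs = Bs \<union> ?N"
      by (auto simp: spanning_sets_def)
    then have "spanning_gf Bs (l *\<^sub>R w) = (\<Sum>T\<in>Bs \<union> ?N. l ^ card T * ?p w T)"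
      by (simp add: spanning_gf_def prod.distrib)
    also have "\<dots> = (\<Sum>T\<in>Bs. l ^ card T * ?p w T) + (\<Sum>T\<in>?N. l ^ card T * ?p w T)"
      by (rule sum.union_disjoint) auto
    also have "(\<Sum>T\<in>Bs. l ^ card T * ?p w T) = l ^ r * basis_gf Bs w"
      by (simp add: basis_gf_def sum_distrib_left rank)
    also have "(\<Sum>T\<in>?N. l ^ card T * ?p w T) = l ^ r * rest"
      unfolding rest_def sum_distrib_left
    proof (rule sum.cong[OF refl])
      fix T assume "T \<in> ?N"
      then have "l ^ card T = l ^ r * l ^ (card T - r)"
        using card_N by (simp flip: power_add add: less_imp_le)
      then show "l ^ card T * ?p w T = l ^ r * (l ^ (card T - r) * ?p w T)" by simp
    qed
    finally have eq: "spanning_gf Bs (l *\<^sub>R w) = l ^ r * (basis_gf Bs w + rest)"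
      by (simp add: distrib_left)
    have "\<bar>rest\<bar> \<le> (\<Sum>T\<in>?N. \<bar>l ^ (card T - r) * ?p w T\<bar>)"
      unfolding rest_def by (rule sum_abs)
    also have "\<dots> \<le> (\<Sum>T\<in>?N. l * \<bar>?p w T\<bar>)"
    proof (rule sum_mono)
      fix T assume "T \<in> ?N"
      then have "l ^ (card T - r) \<le> l ^ 1"
        using card_N l by (intro power_decreasing) (auto simp: Suc_le_eq)
      then show "\<bar>l ^ (card T - r) * ?p w T\<bar> \<le> l * \<bar>?p w T\<bar>"
        using l by (simp add: abs_mult mult_right_mono)
    qed
    also have "\<dots> \<le> l * C"
      using w2[OF w] l by (simp add: C_def flip: sum_distrib_left)
    also have "\<dots> < m"
      using l(1) lC by (simp add: distrib_left)
    also have "\<dots> \<le> \<bar>basis_gf Bs w\<bar>"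
      using w1(2)[OF w] by (simp add: m_def)
    finally have "sgn (basis_gf Bs w + rest) = sgn (basis_gf Bs w)"
      by (auto simp: sgn_real_def abs_if split: if_splits)
    then show ?thesis
      using l by (simp add: eq sgn_mult)
  qed
  with l(1) show ?thesis by blast
qed

text \<open>
  The endpoint \<open>v\<close> has pair sums \<open>(\<alpha>, \<beta>, \<gamma>) = (1, 1, -1)\<close>, so the coefficient of \<open>w\<^sub>1\<close> there is
  \<open>-1\<close>; the differences in the three pairs are \<open>3, 3, -3\<close>, and the generating function is \<open>8\<close>.
  Adding \<open>9\<close> to \<open>w\<^sub>1\<close> brings it down to \<open>-1\<close>.
\<close>

lemma fano_exit_path:
  obtains u v y :: "real ^ 7"
  where "u \<in> positive_orthant" "\<And>w. w \<in> closed_segment u v \<Longrightarrow> 0 < basis_gf fano_bases w"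
    "\<And>i. 0 \<le> y $ i" "basis_gf fano_bases (v + y) < 0"
proof
  let ?u = "(\<chi> i. 1) :: real ^ 7"
  let ?v = "(\<chi> i. if i = 3 \<or> i = 5 then -1 else if i = 2 \<or> i = 4 then 2 else if i = 6 then -2 else 1) :: real ^ 7"
  let ?y = "9 *\<^sub>R axis 1 1 :: real ^ 7"
  show "?u \<in> positive_orthant" by (simp add: positive_orthant_def)
  show "0 \<le> ?y $ i" for i by (simp add: axis_def)
  show "basis_gf fano_bases (?v + ?y) < 0"
    by (simp add: basis_gf_fano_labelled[OF fano_labelling_1] axis_def)
  fix w assume "w \<in> closed_segment ?u ?v"
  then obtain t where t: "0 \<le> t" "t \<le> 1" "w = (1 - t) *\<^sub>R ?u + t *\<^sub>R ?v"
    by (auto simp: in_segment)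
  (* On the segment the value is 4 * (7 * t^3 + 3 * t^2 - 15 * t + 7), whose minimum for
     nonnegative t lies near 7/10; splitting off a multiple of (t - 7/10)^2 leaves a linear
     remainder that is positive for t <= 1. *)
  have "basis_gf fano_bases w = 4 * ((7 * t + 64/5) * (t - 7/10)\<^sup>2 + (728/1000 - 51/100 * t))"
    unfolding t(3)
    by (simp add: basis_gf_fano_labelled[OF fano_labelling_1] power2_eq_square algebra_simps)
  also have "\<dots> > 0"
    using t by (simp add: add_nonneg_pos)
  finally show "0 < basis_gf fano_bases w" .
qed

lemma basis_gf_pos:
  assumes "Bs \<noteq> {}" "w \<in> positive_orthant"
  shows "0 < basis_gf Bs w"
  using assms unfolding basis_gf_def positive_orthant_def by (intro sum_pos) (auto intro!: prod_pos)

lemma spanning_gf_pos: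
  assumes "Bs \<noteq> {}" "w \<in> positive_orthant"
  shows "0 < spanning_gf Bs w"
proof -
  have "spanning_sets Bs \<noteq> {}" using assms(1) by (auto simp: spanning_sets_def)
  then show ?thesis
    using basis_gf_pos[of "spanning_sets Bs"] assms(2) by (simp add: basis_gf_def spanning_gf_def)
qed

lemma not_garding_basis_gf_fano: "\<not> garding (basis_gf fano_bases)"
proof
  assume g: "garding (basis_gf fano_bases)"
  obtain u v y where "u \<in> positive_orthant" "\<And>w. w \<in> closed_segment u v \<Longrightarrow> 0 < basis_gf fano_bases w"
    "\<And>i. 0 \<le> y $ i" "basis_gf fano_bases (v + y) < 0"
    using fano_exit_path by metis
  then show False
    using garding_segment[OF g basis_gf_pos, of u v y] matroid.nonempty[OF fano_matroid] by fastforce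
qed

lemma not_garding_spanning_gf_fano: "\<not> garding (spanning_gf fano_bases)"
proof
  assume g: "garding (spanning_gf fano_bases)"
  obtain u v y where u: "u \<in> positive_orthant"
    and seg: "\<And>w. w \<in> closed_segment u v \<Longrightarrow> 0 < basis_gf fano_bases w"
    and y: "\<And>i. 0 \<le> y $ i" and exit: "basis_gf fano_bases (v + y) < 0"
    using fano_exit_path by metis
  have rank: "card B = 3" if "B \<in> fano_bases" for B
    using that by (simp add: fano_bases_def)
  have compact: "compact (insert (v + y) (closed_segment u v))"
    by simp
  have nz: "basis_gf fano_bases w \<noteq> 0" if "w \<in> insert (v + y) (closed_segment u v)" for w
    using that seg[of w] exit by auto
  obtain l where l: "0 < l"
    and sgn: "\<And>w. w \<in> insert (v + y) (closed_segment u v) \<Longrightarrow>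
      sgn (spanning_gf fano_bases (l *\<^sub>R w)) = sgn (basis_gf fano_bases w)"
    using sgn_spanning_gf_small_scale[OF rank compact nz] by blast
  have "0 < spanning_gf fano_bases (l *\<^sub>R v + l *\<^sub>R y)"
  proof (rule garding_segment[OF g spanning_gf_pos])
    show "l *\<^sub>R u \<in> positive_orthant" using u l by (simp add: positive_orthant_def)
    show "0 \<le> (l *\<^sub>R y) $ i" for i using y l by simp
    fix w assume "w \<in> closed_segment (l *\<^sub>R u) (l *\<^sub>R v)"
    then obtain t where t: "0 \<le> t" "t \<le> 1" "w = (1 - t) *\<^sub>R l *\<^sub>R u + t *\<^sub>R l *\<^sub>R v"
      unfolding in_segment by blast
    define w' where "w' = (1 - t) *\<^sub>R u + t *\<^sub>R v"
    have "w' \<in> closed_segment u v" "w = l *\<^sub>R w'"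
      using t unfolding in_segment w'_def by (blast, simp add: scaleR_add_right mult.commute)
    then show "0 < spanning_gf fano_bases w"
      using sgn[of w'] seg[of w'] by (simp add: sgn_1_pos)
  qed (use matroid.nonempty[OF fano_matroid] in auto)
  then show False
    using sgn[of "v + y"] exit by (simp add: scaleR_add_right sgn_1_pos)
qed

theorem proposition14p10:
  "rayleigh (basis_gf fano_bases) \<and> rayleigh (spanning_gf fano_bases) \<and>
   \<not> garding (basis_gf fano_bases) \<and> \<not> garding (spanning_gf fano_bases)"
  by (intro conjI rayleigh_basis_gf_fano rayleigh_spanning_gf_fano
      not_garding_basis_gf_fano not_garding_spanning_gf_fano)

end
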